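(* Let $n,m\ge0$ be integers with $n+m\ge1$, let $p\ge2$ be an integer, and let $q=e^{i\phi}$ with $-\frac{\pi}{p}<\phi<\frac{\pi}{p}$. Let $(\cdot,\cdot)$ be the Hermitian form on the Fock module $W_p$ of $U_q[sl(n+1|m)]$ with $(|0\rangle,|0\rangle)=1$ and $(a_i^\pm v,w)=(v,a_i^\mp w)$, $(H_iv,w)=(v,H_iw)$ for all $v,w\in W_p$, $i\in[1;n+m]$. Then the vectors $$|p;r_1,\dots,r_{n+m})=\sqrt{\frac{[p-\sum_{l=1}^{n+m}r_l]!}{[p]!\,[r_1]!\cdots[r_{n+m}]!}}\;|p;r_1,\dots,r_{n+m}\rangle,\qquad 0\le\sum_{i=1}^{n+m}r_i\le p,$$ form an orthonormal basis of $W_p$, and in this basis the Jacobson generators act by ($i\in[1;n+m]$) $$H_i|p;r_1,\dots,r_{n+m})=\Bigl(p-(-1)^{\theta_i}r_i-\sum_{j=1}^{n+m}r_j\Bigr)|p;r_1,\dots,r_{n+m}),$$ $$a_i^-|p;r_1,\dots,r_{n+m})=(-1)^{\theta_1r_1+\cdots+\theta_{i-1}r_{i-1}}q^{r_1+\cdots+r_{i-1}}\sqrt{[r_i]\Bigl[p-\sum_{l=1}^{n+m}r_l+1\Bigr]}\;|p;r_1,\dots,r_i-1,\dots,r_{n+m}),$$ $$a_i^+|p;r_1,\dots,r_{n+m})=(-1)^{\theta_1r_1+\cdots+\theta_{i-1}r_{i-1}}\bar q^{\,r_1+\cdots+r_{i-1}}(1-\theta_ir_i)\sqrt{[r_i+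1]\Bigl[p-\sum_{l=1}^{n+m}r_l\Bigr]}\;|p;r_1,\dots,r_i+1,\dots,r_{n+m}).$$
   Context: Notation: for an integer $k\geq 0$, $[k]=\frac{q^k-q^{-k}}{q-q^{-1}}=q^{k-1}+q^{k-3}+\cdots+q^{-(k-1)}$ (so $[k]=k$ at $q=1$), $[k]!=[k][k-1]\cdots[1]$, $[0]!=1$; $[r;s]=\{r,\dots,s\}$; $\theta_i=0$ for $i\in[1;n]$, $\theta_i=1$ for $i\in[n+1;n+m]$; $\bar q=q^{-1}$. The Fock module $W_p$ of the quantum superalgebra $U_q[sl(n+1|m)]$ is the finite-dimensional complex vector space with basis $|p;r_1,\dots,r_{n+m}\rangle$, where $r_i\in\mathbb Z_{\ge0}$ for $i\in[1;n]$, $r_i\in\{0,1\}$ for $i\in[n+1;n+m]$ and $\sum_ir_i\le p$. The Jacobson generators $H_i,a_i^+,a_i^-$ ($i\in[1;n+m]$), which generate $U_q[sl(n+1|m)]$, act by $$H_i|p;r_1,\dots,r_{n+m}\rangle=\Bigl(p-(-1)^{\theta_i}r_i-\sum_jr_j\Bigr)|p;r_1,\dots,r_{n+m}\rangle,$$ $$a_i^-|p;r_1,\dots,r_{n+m}\rangle=(-1)^{\theta_1r_1+\cdots+\theta_{i-1}r_{i-1}}q^{r_1+\cdots+r_{i-1}}[r_i]\Bigl[p-\sum_jr_j+1\Bigr]|p;r_1,\dots,r_i-1,\dots,r_{n+m}\rangle,$$ $$a_i^+|p;r_1,\dots,r_{n+m}\rangle=(-1)^{\theta_1r_1+\cdots+\theta_{i-1}r_{i-1}}\bar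 q^{\,r_1+\cdots+r_{i-1}}(1-\theta_ir_i)|p;r_1,\dots,r_i+1,\dots,r_{n+m}\rangle,$$ where terms with vanishing coefficient are zero and vectors with $\sum_jr_j>p$ are replaced by $0$. $|0\rangle=|p;0,\dots,0\rangle$. Under the stated condition on $q$ the numbers $[1],\dots,[p]$ are positive, and square roots are the nonnegative ones; terms with vanishing coefficient are read as zero. *)

theory Defs
  imports Complex_Main "HOL-Library.Function_Algebras"
begin

text \<open>The polynomial form \<open>q^(k-1) + q^(k-3) + \<dots> + q^(-(k-1))\<close> also covers \<open>q = q^(-1)\<close>;
  lemma \<open>qnum_eq_quotient\<close> recovers the usual quotient.\<close>

definition qnum :: "complex \<Rightarrow> nat \<Rightarrow> complex" where
  "qnum q k = (\<Sum>j<k. q powi (int k - 1 - 2 * int j))"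

definition qfact :: "complex \<Rightarrow> nat \<Rightarrow> complex" where
  "qfact q k = (\<Prod>j=1..k. qnum q j)"

lemma qnum_Suc:
  assumes "q \<noteq> 0"
  shows "qnum q (Suc k) = q * qnum q k + inverse q ^ k"
proof -
  have 1: "q powi (int (Suc k) - 1 - 2 * int j) = q * q powi (int k - 1 - 2 * int j)" for j
    using assms by (simp add: power_int_add_1' [symmetric] algebra_simps)
  have 2: "q powi (int (Suc k) - 1 - 2 * int k) = inverse q ^ k"
    by (simp add: power_int_minus power_inverse)
  show ?thesis
    by (simp only: qnum_def sum.lessThan_Suc sum_distrib_left 2) (simp only: 1)
qed

lemma qnum_eq_quotient:
  assumes "q \<noteq> 0" "q \<noteq> inverse q"
  shows "qnum q k = (q ^ k - inverse q ^ k) / (q - inverse q)"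
proof -
  have "(q - inverse q) * qnum q k = q ^ k - inverse q ^ k"
  proof (induction k)
    case 0
    show ?case by (simp add: qnum_def)
  next
    case (Suc k)
    have "(q - inverse q) * qnum q (Suc k)
        = q * ((q - inverse q) * qnum q k) + (q - inverse q) * inverse q ^ k"
      by (simp add: qnum_Suc[OF assms(1)] algebra_simps)
    also have "\<dots> = q ^ Suc k - inverse q ^ Suc k"
      unfolding Suc by (simp add: algebra_simps)
    finally show ?case .
  qed
  then show ?thesis
    using assms(2) by (simp add: field_simps)
qed

definition cscale :: "complex \<Rightarrow> ('a \<Rightarrow> complex) \<Rightarrow> 'a \<Rightarrow> complex"  (infixr "*\<^sub>C" 75) where
  "c *\<^sub>C v = (\<lambda>s. c * v s)"

global_interpretation cfun: vector_space "cscale :: complex \<Rightarrow> ('a \<Rightarrow> complex) \<Rightarrow> 'a \<Rightarrow> complex"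
  by unfold_locales (simp_all add: cscale_def fun_eq_iff algebra_simps)

text \<open>No positivity is required of a Hermitian form. It is linear in the first argument, hence by
  symmetry conjugate-linear in the second.\<close>

definition hermitian_form_on ::
    "('a \<Rightarrow> complex) set \<Rightarrow> (('a \<Rightarrow> complex) \<Rightarrow> ('a \<Rightarrow> complex) \<Rightarrow> complex) \<Rightarrow> bool" where
  "hermitian_form_on V B \<longleftrightarrow>
     (\<forall>u\<in>V. \<forall>v\<in>V. \<forall>w\<in>V. B (u + v) w = B u w + B v w) \<and>
     (\<forall>c. \<forall>v\<in>V. \<forall>w\<in>V. B (c *\<^sub>C v) w = c * B v w) \<and>
     (\<forall>v\<in>V. \<forall>w\<in>V. B w v = cnj (B v w))"

definition orthonormal_basis_on ::
    "('a \<Rightarrow> complex) set \<Rightarrow> (('a \<Rightarrow> complex) \<Rightarrow> ('a \<Rightarrow> complex) \<Rightarrow> complex)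
      \<Rightarrow> 'i set \<Rightarrow> ('i \<Rightarrow> 'a \<Rightarrow> complex) \<Rightarrow> bool" where
  "orthonormal_basis_on V B I b \<longleftrightarrow>
     inj_on b I \<and> cfun.independent (b ` I) \<and> cfun.span (b ` I) = V \<and>
     (\<forall>r\<in>I. \<forall>s\<in>I. B (b r) (b s) = (if r = s then 1 else 0))"

definition theta :: "nat \<Rightarrow> nat \<Rightarrow> nat" where
  "theta n i = (if i \<le> n then 0 else 1)"

text \<open>A label \<open>(r_1, \<dots>, r_(n+m))\<close> is a function on \<open>nat\<close> that is zero outside \<open>{1..n+m}\<close>.\<close>

definition total :: "nat \<Rightarrow> nat \<Rightarrow> (nat \<Rightarrow> nat) \<Rightarrow> nat" where
  "total n m r = (\<Sum>j=1..n+m. r j)"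

definition labels :: "nat \<Rightarrow> nat \<Rightarrow> nat \<Rightarrow> (nat \<Rightarrow> nat) set" where
  "labels n m p =
     {r. (\<forall>i. i \<notin> {1..n+m} \<longrightarrow> r i = 0) \<and> (\<forall>i\<in>{n+1..n+m}. r i \<in> {0, 1}) \<and> total n m r \<le> p}"

text \<open>\<open>fock n m p\<close> is the complex vector space with basis the (finitely many) labels, a vector
  being its coordinate function. \<open>ket n m p r\<close> is the basis vector at \<open>r\<close>, and \<open>0\<close> if \<open>r\<close> is not a
  label, in particular if its total exceeds \<open>p\<close>.\<close>

definition fock :: "nat \<Rightarrow> nat \<Rightarrow> nat \<Rightarrow> ((nat \<Rightarrow> nat) \<Rightarrow> complex) set" where
  "fock n m p = {v. \<forall>r. r \<notin> labels n m p \<longrightarrow> v r = 0}"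

definition ket :: "nat \<Rightarrow> nat \<Rightarrow> nat \<Rightarrow> (nat \<Rightarrow> nat) \<Rightarrow> (nat \<Rightarrow> nat) \<Rightarrow> complex" where
  "ket n m p r = (\<lambda>s. if s = r \<and> r \<in> labels n m p then 1 else 0)"

definition vacuum :: "nat \<Rightarrow> nat \<Rightarrow> nat \<Rightarrow> (nat \<Rightarrow> nat) \<Rightarrow> complex" where
  "vacuum n m p = ket n m p (\<lambda>_. 0)"

definition lin_ext ::
    "nat \<Rightarrow> nat \<Rightarrow> nat \<Rightarrow> ((nat \<Rightarrow> nat) \<Rightarrow> (nat \<Rightarrow> nat) \<Rightarrow> complex)
      \<Rightarrow> ((nat \<Rightarrow> nat) \<Rightarrow> complex) \<Rightarrow> (nat \<Rightarrow> nat) \<Rightarrow> complex" where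
  "lin_ext n m p F v = (\<Sum>r\<in>labels n m p. v r *\<^sub>C F r)"

definition jsign :: "nat \<Rightarrow> nat \<Rightarrow> (nat \<Rightarrow> nat) \<Rightarrow> complex" where
  "jsign n i r = (-1) ^ (\<Sum>j=1..<i. theta n j * r j)"

definition weight :: "nat \<Rightarrow> nat \<Rightarrow> nat \<Rightarrow> nat \<Rightarrow> (nat \<Rightarrow> nat) \<Rightarrow> complex" where
  "weight n m p i r = of_nat p - (-1) ^ theta n i * of_nat (r i) - of_nat (total n m r)"

text \<open>The Jacobson generators \<open>H_i\<close>, \<open>a_i^-\<close>, \<open>a_i^+\<close>. For a label \<open>r\<close>, the truncated subtraction
  \<open>p - total n m r\<close> is exact, and \<open>r i - 1\<close> truncates only where the coefficient \<open>qnum q 0\<close>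
  vanishes.\<close>

definition jac_H ::
    "nat \<Rightarrow> nat \<Rightarrow> nat \<Rightarrow> nat \<Rightarrow> ((nat \<Rightarrow> nat) \<Rightarrow> complex) \<Rightarrow> (nat \<Rightarrow> nat) \<Rightarrow> complex" where
  "jac_H n m p i = lin_ext n m p (\<lambda>r. weight n m p i r *\<^sub>C ket n m p r)"

definition jac_minus ::
    "nat \<Rightarrow> nat \<Rightarrow> nat \<Rightarrow> complex \<Rightarrow> nat
      \<Rightarrow> ((nat \<Rightarrow> nat) \<Rightarrow> complex) \<Rightarrow> (nat \<Rightarrow> nat) \<Rightarrow> complex" where
  "jac_minus n m p q i = lin_ext n m p (\<lambda>r.
     (jsign n i r * q ^ (\<Sum>j=1..<i. r j) * qnum q (r i) * qnum q (p - total n m r + 1))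
       *\<^sub>C ket n m p (r(i := r i - 1)))"

definition jac_plus ::
    "nat \<Rightarrow> nat \<Rightarrow> nat \<Rightarrow> complex \<Rightarrow> nat
      \<Rightarrow> ((nat \<Rightarrow> nat) \<Rightarrow> complex) \<Rightarrow> (nat \<Rightarrow> nat) \<Rightarrow> complex" where
  "jac_plus n m p q i = lin_ext n m p (\<lambda>r.
     (jsign n i r * inverse q ^ (\<Sum>j=1..<i. r j) * (1 - of_nat (theta n i * r i)))
       *\<^sub>C ket n m p (r(i := r i + 1)))"

definition fock_form ::
    "nat \<Rightarrow> nat \<Rightarrow> nat \<Rightarrow> complex
      \<Rightarrow> (((nat \<Rightarrow> nat) \<Rightarrow> complex) \<Rightarrow> ((nat \<Rightarrow> nat) \<Rightarrow> complex) \<Rightarrow> complex) \<Rightarrow> bool" where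
  "fock_form n m p q B \<longleftrightarrow>
     hermitian_form_on (fock n m p) B \<and>
     B (vacuum n m p) (vacuum n m p) = 1 \<and>
     (\<forall>i\<in>{1..n+m}. \<forall>v\<in>fock n m p. \<forall>w\<in>fock n m p.
        B (jac_plus n m p q i v) w = B v (jac_minus n m p q i w) \<and>
        B (jac_minus n m p q i v) w = B v (jac_plus n m p q i w) \<and>
        B (jac_H n m p i v) w = B v (jac_H n m p i w))"

text \<open>The vectors \<open>|p; r_1, \<dots>, r_(n+m))\<close>. The radicand is a nonnegative real number for the \<open>q\<close>
  of interest, so that \<^const>\<open>csqrt\<close> is the nonnegative square root.\<close>

definition nket ::
    "nat \<Rightarrow> nat \<Rightarrow> nat \<Rightarrow> complex \<Rightarrow> (nat \<Rightarrow> nat) \<Rightarrow> (nat \<Rightarrow> nat) \<Rightarrow> complex" where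
  "nket n m p q r =
     csqrt (qfact q (p - total n m r) / (qfact q p * (\<Prod>i=1..n+m. qfact q (r i))))
       *\<^sub>C ket n m p r"

end

theory Submission
  imports Defs
begin

text \<open>On the basis \<open>|p; r\<rangle>\<close> the adjointness relations force orthogonality and
  \<open>(|p; r\<rangle>, |p; r\<rangle>) = [p]! \<Prod> [r_i]! / [p - \<Sum> r_i]!\<close>: every basis vector is a nonzero multiple
  of some \<open>a_i^+\<close> applied to a vector of smaller total, and moving \<open>a_i^+\<close> to the other side gives
  a recursion on the total. Conversely, the diagonal form with these entries satisfies the
  relations. Since \<open>[k] = sin (k \<phi>) / sin \<phi>\<close> is positive for \<open>1 \<le> k \<le> p\<close>, the entries are positive
  and the basis can be normalized.\<close>

section \<open>Quantum integers on the unit circle\<close>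

lemma qnum_0 [simp]: "qnum q 0 = 0"
  by (simp add: qnum_def)

lemma qnum_one: "qnum 1 k = of_nat k"
  by (simp add: qnum_def)

text \<open>De Moivre turns numerator and denominator of the quotient formula into sines; a nonzero
  \<open>sin \<phi>\<close> is what rules out \<open>q = inverse q\<close>.\<close>

lemma qnum_exp_i:
  assumes "sin \<phi> \<noteq> 0"
  shows "qnum (exp (\<i> * complex_of_real \<phi>)) k = complex_of_real (sin (real k * \<phi>) / sin \<phi>)"
proof -
  define q where "q = exp (\<i> * complex_of_real \<phi>)"
  have diff: "q ^ j - inverse q ^ j = 2 * \<i> * complex_of_real (sin (real j * \<phi>))" for j
  proof -
    have "q ^ j = cis (real j * \<phi>)" "inverse q ^ j = cis (- (real j * \<phi>))"
      unfolding q_def cis_conv_exp [symmetric] by (simp_all add: Complex.DeMoivre)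
    then show ?thesis
      by (simp add: complex_eq_iff)
  qed
  have "q - inverse q = 2 * \<i> * complex_of_real (sin \<phi>)"
    using diff [of 1] by simp
  moreover from this have "q \<noteq> inverse q"
    using assms by auto
  ultimately show ?thesis
    unfolding q_def [symmetric]
    by (subst qnum_eq_quotient) (use diff [of k] in \<open>simp_all add: q_def\<close>)
qed

text \<open>For nonzero angle and \<open>1 \<le> j \<le> p\<close>, the number
  \<open>j * \<bar>\<phi>\<bar>\<close> lies strictly between 0 and pi, where the sine is positive.
  At angle zero, \<open>q = 1\<close> and the value is \<open>k\<close>.\<close>

lemma qnum_exp_i_pos:
  assumes "\<bar>\<phi>\<bar> < pi / real p" "1 \<le> k" "k \<le> p"
  shows "\<exists>x>0. qnum (exp (\<i> * complex_of_real \<phi>)) k = complex_of_real x"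
proof (cases "\<phi> = 0")
  case True
  then show ?thesis
    using assms(2) by (intro exI [of _ "real k"]) (simp add: qnum_one)
next
  case False
  have p: "real p > 0"
    using assms by simp
  have pos: "sin (real j * \<bar>\<phi>\<bar>) > 0" if "1 \<le> j" "j \<le> p" for j
  proof (rule sin_gt_zero)
    show "0 < real j * \<bar>\<phi>\<bar>"
      using that False by simp
    have "real j * \<bar>\<phi>\<bar> \<le> real p * \<bar>\<phi>\<bar>"
      using that by (intro mult_right_mono) auto
    also have "\<dots> < pi"
      using assms(1) p by (simp add: field_simps)
    finally show "real j * \<bar>\<phi>\<bar> < pi" .
  qed
  \<comment> \<open>Sine is odd, so the two signs cancel in the quotient and the angle may be taken
    positive.\<close>
  have "sin (real k * \<phi>) / sin \<phi> = sin (real k * \<bar>\<phi>\<bar>) / sin \<bar>\<phi>\<bar>"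
    by (simp add: abs_if)
  also have "\<dots> > 0"
    using pos [of k] pos [of 1] assms(2,3) by (intro divide_pos_pos) auto
  finally have "sin (real k * \<phi>) / sin \<phi> > 0" .
  moreover from this have "sin \<phi> \<noteq> 0"
    by auto
  ultimately show ?thesis
    using qnum_exp_i by blast
qed

section \<open>Labels under raising and lowering\<close>

lemma finite_labels: "finite (labels n m p)"
proof (rule finite_subset)
  show "labels n m p \<subseteq>
      {r. \<forall>i. (i \<in> {1..n+m} \<longrightarrow> r i \<in> {..p}) \<and> (i \<notin> {1..n+m} \<longrightarrow> r i = 0)}"
  proof (intro subsetI CollectI allI conjI impI)
    fix r i
    assume r: "r \<in> labels n m p"
    show "r i = 0" if "i \<notin> {1..n+m}"
      using r that by (simp add: labels_def)
    show "r i \<in> {..p}" if "i \<in> {1..n+m}"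
      using r member_le_sum [of i "{1..n+m}" r] that by (auto simp: labels_def total_def)
  qed
qed (rule finite_set_of_finite_funs; simp)

lemma label_le:
  assumes "r \<in> labels n m p"
  shows "r i \<le> total n m r"
proof (cases "i \<in> {1..n+m}")
  case True
  then show ?thesis
    using member_le_sum [of i "{1..n+m}" r] by (simp add: total_def)
qed (use assms in \<open>auto simp: labels_def\<close>)

lemma zero_label: "(\<lambda>_. 0) \<in> labels n m p"
  by (simp add: labels_def total_def)

lemma total_raise:
  assumes "i \<in> {1..n+m}"
  shows "total n m (r(i := Suc (r i))) = Suc (total n m r)"
  using assms by (simp add: total_def sum.remove [of _ i])

lemma fermionic_label_le:
  assumes "r \<in> labels n m p" "j \<in> {n+1..n+m}"
  shows "r j \<le> 1"
proof -
  have "\<forall>j\<in>{n+1..n+m}. r j \<in> {0, 1}"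
    using assms(1) unfolding labels_def mem_Collect_eq by (elim conjE)
  then have "r j \<in> {0, 1}"
    using assms(2) by (rule bspec)
  then show ?thesis
    by auto
qed

lemma lower_label:
  assumes "r \<in> labels n m p" "i \<in> {1..n+m}" "r i > 0"
  shows "r(i := r i - 1) \<in> labels n m p"
  unfolding labels_def mem_Collect_eq
proof (intro conjI allI ballI impI)
  have "total n m r = Suc (total n m (r(i := r i - 1)))"
    using total_raise [OF assms(2), of "r(i := r i - 1)"] assms(3) by simp
  moreover have "total n m r \<le> p"
    using assms(1) by (simp add: labels_def)
  ultimately show "total n m (r(i := r i - 1)) \<le> p"
    by linarith
  show "(r(i := r i - 1)) j = 0" if "j \<notin> {1..n+m}" for j
    using assms(1,2) that unfolding labels_def by auto
  show "(r(i := r i - 1)) j \<in> {0, 1}" if "j \<in> {n+1..n+m}" for j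
    using fermionic_label_le [OF assms(1) that] by (cases "r j") auto
qed

text \<open>A fermionic entry that can still be raised must be 0. Hence the factor
  \<open>1 - theta n i * r i\<close> in the raising generator equals 1 whenever the target is a
  label.\<close>

lemma raised_label_theta:
  assumes "r(i := Suc (r i)) \<in> labels n m p" "i \<in> {1..n+m}"
  shows "theta n i * r i = 0"
proof (cases "i \<le> n")
  case False
  then show ?thesis
    using fermionic_label_le [OF assms(1), of i] assms(2) by simp
qed (simp add: theta_def)

section \<open>Kets, linear extension, Hermitian forms and rescaled bases\<close>

lemma ket_apply: "ket n m p r s = (if s = r \<and> r \<in> labels n m p then 1 else 0)"
  by (simp add: ket_def)

lemma ket_eq_0: "r \<notin> labels n m p \<Longrightarrow> ket n m p r = 0"
  by (simp add: ket_def fun_eq_iff)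

lemma ket_in_fock: "ket n m p r \<in> fock n m p"
  by (simp add: fock_def ket_def)

lemma sum_fun_apply: "sum f A x = (\<Sum>a\<in>A. f a x)"
  by (induction A rule: infinite_finite_induct) auto

lemma cscale_apply: "(c *\<^sub>C v) s = c * v s"
  by (simp add: cscale_def)

lemma lin_ext_apply: "lin_ext n m p F v s = (\<Sum>r\<in>labels n m p. v r * F r s)"
  by (simp add: lin_ext_def sum_fun_apply cscale_apply)

lemma lin_ext_ket:
  assumes "r \<in> labels n m p"
  shows "lin_ext n m p F (c *\<^sub>C ket n m p r) = c *\<^sub>C F r"
proof
  fix s
  have "lin_ext n m p F (c *\<^sub>C ket n m p r) s
      = (\<Sum>r'\<in>labels n m p. if r' = r then c * F r s else 0)"
    unfolding lin_ext_apply by (intro sum.cong) (auto simp: cscale_apply ket_apply assms)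
  then show "lin_ext n m p F (c *\<^sub>C ket n m p r) s = (c *\<^sub>C F r) s"
    using assms by (simp add: finite_labels cscale_apply)
qed

lemma hermitian_form_scale_left:
  assumes "hermitian_form_on V B" "v \<in> V" "w \<in> V"
  shows "B (c *\<^sub>C v) w = c * B v w"
  by (rule assms(1) [unfolded hermitian_form_on_def, THEN conjunct2, THEN conjunct1,
        rule_format, OF assms(2,3)])

lemma hermitian_form_sym:
  assumes "hermitian_form_on V B" "v \<in> V" "w \<in> V"
  shows "B w v = cnj (B v w)"
  by (rule assms(1) [unfolded hermitian_form_on_def, THEN conjunct2, THEN conjunct2,
        rule_format, OF assms(2,3)])

lemma hermitian_form_scale_right:
  assumes "hermitian_form_on V B" "v \<in> V" "w \<in> V" "c *\<^sub>C w \<in> V"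
  shows "B v (c *\<^sub>C w) = cnj c * B v w"
proof -
  have "B v (c *\<^sub>C w) = cnj (B (c *\<^sub>C w) v)"
    by (rule hermitian_form_sym [OF assms(1,4,2)])
  also have "\<dots> = cnj c * cnj (B w v)"
    by (simp only: hermitian_form_scale_left [OF assms(1,3,2)] complex_cnj_mult)
  also have "cnj (B w v) = B v w"
    by (rule hermitian_form_sym [OF assms(1,3,2), symmetric])
  finally show ?thesis .
qed

lemma subspace_fock: "cfun.subspace (fock n m p)"
  by (auto simp: cfun.subspace_def fock_def cscale_apply)

text \<open>Each \<open>b r\<close> is supported at the single point \<open>r\<close>, so evaluating
  a linear combination at \<open>r\<close> isolates one coefficient. This yields independence, and
  division by \<open>c r\<close> yields the expansion of any vector.\<close>

lemma scaled_kets_basis: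
  assumes c: "\<And>r. r \<in> labels n m p \<Longrightarrow> c r \<noteq> 0"
  defines "b \<equiv> \<lambda>r. c r *\<^sub>C ket n m p r"
  shows "inj_on b (labels n m p)"
    and "cfun.independent (b ` labels n m p)"
    and "cfun.span (b ` labels n m p) = fock n m p"
proof -
  let ?L = "labels n m p"
  have b_apply: "b r s = (if s = r then c r else 0)" if "r \<in> ?L" for r s
    using that by (simp add: b_def cscale_apply ket_apply)
  show inj: "inj_on b ?L"
    by (rule inj_onI) (metis b_apply c)
  have expand: "(\<Sum>r\<in>?L. u r *\<^sub>C b r) s = (if s \<in> ?L then u s * c s else 0)" for u s
  proof -
    have "(\<Sum>r\<in>?L. u r *\<^sub>C b r) s = (\<Sum>r\<in>?L. if r = s then u s * c s else 0)"
      unfolding sum_fun_apply by (intro sum.cong) (auto simp: cscale_apply b_apply)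
    then show ?thesis
      by (simp add: finite_labels)
  qed
  show "cfun.independent (b ` ?L)"
  proof (rule ccontr)
    assume "\<not> cfun.independent (b ` ?L)"
    then obtain u v where v: "v \<in> b ` ?L" "u v \<noteq> 0"
      and "(\<Sum>w\<in>b ` ?L. u w *\<^sub>C w) = 0"
      by (auto simp: cfun.dependent_finite finite_labels)
    then have 0: "(\<Sum>r\<in>?L. u (b r) *\<^sub>C b r) = 0"
      by (simp add: sum.reindex [OF inj])
    from v obtain r where "r \<in> ?L" "v = b r"
      by blast
    then show False
      using expand [of "\<lambda>r. u (b r)" r] 0 c v(2) by simp
  qed
  show "cfun.span (b ` ?L) = fock n m p"
  proof
    have "b ` ?L \<subseteq> fock n m p"
      by (auto simp: b_def intro!: cfun.subspace_scale subspace_fock ket_in_fock)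
    then show "cfun.span (b ` ?L) \<subseteq> fock n m p"
      by (intro cfun.span_minimal subspace_fock)
    show "fock n m p \<subseteq> cfun.span (b ` ?L)"
    proof
      fix v
      assume "v \<in> fock n m p"
      then have "v = (\<Sum>r\<in>?L. (v r / c r) *\<^sub>C b r)"
        by (intro ext) (auto simp: expand c fock_def)
      also have "\<dots> \<in> cfun.span (b ` ?L)"
        by (intro cfun.span_sum cfun.span_scale cfun.span_base imageI)
      finally show "v \<in> cfun.span (b ` ?L)" .
    qed
  qed
qed

section \<open>The abstract setting: unimodular \<open>q\<close> with positive quantum integers up
  to \<open>p\<close>\<close>

locale unitary_fock =
  fixes n m p :: nat and q :: complex
  assumes q_nonzero: "q \<noteq> 0"
    and cnj_q: "cnj q = inverse q"
    and qnum_pos: "1 \<le> k \<Longrightarrow> k \<le> p \<Longrightarrow> \<exists>x>0. qnum q k = complex_of_real x"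
begin

abbreviation "L \<equiv> labels n m p"
abbreviation "N \<equiv> total n m"
abbreviation "K \<equiv> ket n m p"

text \<open>Up to \<open>p\<close> the quantum integers are real, so the real part loses nothing
  there and makes order and \<open>sqrt\<close> available.\<close>

definition rnum :: "nat \<Rightarrow> real" where
  "rnum k = Re (qnum q k)"

definition rfact :: "nat \<Rightarrow> real" where
  "rfact k = (\<Prod>j=1..k. rnum j)"

lemma rnum_pos: "1 \<le> k \<Longrightarrow> k \<le> p \<Longrightarrow> rnum k > 0"
  using qnum_pos [of k] by (auto simp: rnum_def)

lemma qnum_rnum: "k \<le> p \<Longrightarrow> qnum q k = complex_of_real (rnum k)"
  using qnum_pos [of k] by (cases "k = 0") (auto simp: rnum_def)

lemma rnum_nonneg: "k \<le> p \<Longrightarrow> rnum k \<ge> 0"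
  using rnum_pos [of k] by (cases "k = 0") (auto simp: rnum_def)

lemma rfact_pos: "k \<le> p \<Longrightarrow> rfact k > 0"
  unfolding rfact_def by (intro prod_pos) (auto intro: rnum_pos)

lemma qfact_rfact: "k \<le> p \<Longrightarrow> qfact q k = complex_of_real (rfact k)"
  by (simp add: qfact_def rfact_def qnum_rnum)

lemma rfact_Suc: "rfact (Suc k) = rfact k * rnum (Suc k)"
  by (simp add: rfact_def)

text \<open>The value of \<open>(|p; r\<rangle>, |p; r\<rangle>)\<close>.\<close>

definition normsq :: "(nat \<Rightarrow> nat) \<Rightarrow> real" where
  "normsq r = rfact p * (\<Prod>i=1..n+m. rfact (r i)) / rfact (p - N r)"

lemma total_le: "r \<in> L \<Longrightarrow> N r \<le> p"
  by (simp add: labels_def)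

lemma label_le_p: "r \<in> L \<Longrightarrow> r i \<le> p"
  by (rule le_trans [OF label_le total_le])

lemma normsq_pos:
  assumes "r \<in> L"
  shows "normsq r > 0"
  by (simp add: normsq_def rfact_pos label_le_p [OF assms] prod_pos)

lemma normsq_zero: "normsq (\<lambda>_. 0) = 1"
  using rfact_pos [of p] by (simp add: normsq_def total_def) (simp add: rfact_def)

text \<open>Raising multiplies the factorial of the entry by \<open>[r_i + 1]\<close> and strips the
  factor \<open>[p - N r]\<close> from the factorial in the denominator. As the raised label has
  total at most \<open>p\<close>, the latter factor is nonzero.\<close>

lemma normsq_raise:
  assumes i: "i \<in> {1..n+m}" and r: "r(i := Suc (r i)) \<in> L"
  shows "normsq (r(i := Suc (r i))) = rnum (Suc (r i)) * rnum (p - N r) * normsq r"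
proof -
  have le: "Suc (N r) \<le> p"
    using total_le [OF r] by (simp only: total_raise [OF i])
  define k where "k = p - Suc (N r)"
  have k: "p - N r = Suc k"
    using le by (simp add: k_def)
  then have "Suc k \<le> p"
    by (metis diff_le_self)
  have "(\<Prod>j=1..n+m. rfact ((r(i := Suc (r i))) j))
      = rnum (Suc (r i)) * (\<Prod>j=1..n+m. rfact (r j))"
    using i by (simp add: prod.remove [of _ i] rfact_Suc)
  then have "normsq (r(i := Suc (r i)))
      = rfact p * (rnum (Suc (r i)) * (\<Prod>j=1..n+m. rfact (r j))) / rfact k"
    by (simp only: normsq_def total_raise [OF i] k_def)
  moreover have "rfact k \<noteq> 0" "rnum (Suc k) \<noteq> 0"
    using rfact_pos [of k] rnum_pos [of "Suc k"] \<open>Suc k \<le> p\<close> by auto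
  ultimately show ?thesis
    by (simp add: normsq_def k rfact_Suc)
qed

section \<open>Matrix coefficients of the Jacobson generators\<close>

definition plus_coeff :: "nat \<Rightarrow> (nat \<Rightarrow> nat) \<Rightarrow> complex" where
  "plus_coeff i r = jsign n i r * inverse q ^ (\<Sum>j=1..<i. r j) * (1 - of_nat (theta n i * r i))"

definition minus_coeff :: "nat \<Rightarrow> (nat \<Rightarrow> nat) \<Rightarrow> complex" where
  "minus_coeff i r =
     jsign n i r * q ^ (\<Sum>j=1..<i. r j) * qnum q (r i) * qnum q (p - N r + 1)"

lemma jac_plus_ket:
  "r \<in> L \<Longrightarrow> jac_plus n m p q i (c *\<^sub>C K r) = (c * plus_coeff i r) *\<^sub>C K (r(i := Suc (r i)))"
  unfolding jac_plus_def by (subst lin_ext_ket) (simp_all add: plus_coeff_def)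

lemma jac_minus_ket:
  "r \<in> L \<Longrightarrow> jac_minus n m p q i (c *\<^sub>C K r) = (c * minus_coeff i r) *\<^sub>C K (r(i := r i - 1))"
  unfolding jac_minus_def by (subst lin_ext_ket) (simp_all add: minus_coeff_def)

lemma jac_H_ket:
  "r \<in> L \<Longrightarrow> jac_H n m p i (c *\<^sub>C K r) = weight n m p i r *\<^sub>C (c *\<^sub>C K r)"
  unfolding jac_H_def by (subst lin_ext_ket) (simp_all add: mult.commute)

lemma jsign_upd: "jsign n i (r(i := x)) = jsign n i r"
  by (simp add: jsign_def)

lemma sum_before_upd: "(\<Sum>j=1..<i::nat. (r(i := x)) j) = (\<Sum>j=1..<i. r j)"
  by (intro sum.cong) auto

lemma cnj_jsign: "cnj (jsign n i r) = jsign n i r"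
  by (simp add: jsign_def)

text \<open>Allows division by the raising coefficient in the recursion that determines the
  form.\<close>

lemma plus_coeff_nonzero:
  assumes "i \<in> {1..n+m}" "r(i := Suc (r i)) \<in> L"
  shows "plus_coeff i r \<noteq> 0"
  using q_nonzero by (simp add: plus_coeff_def jsign_def raised_label_theta [OF assms(2,1)]
      del: of_nat_mult)

text \<open>The adjointness relation for one pair of neighbouring labels. Sign and exponent involve
  only entries before \<open>i\<close>, so they agree at both labels; conjugation fixes the sign and
  inverts \<open>q\<close>. The two remaining quantum integers are the ratio of the norms.\<close>

lemma normsq_plus_coeff:
  assumes i: "i \<in> {1..n+m}" and r: "r(i := Suc (r i)) \<in> L"
  shows "complex_of_real (normsq (r(i := Suc (r i)))) * plus_coeff i r
      = complex_of_real (normsq r) * cnj (minus_coeff i (r(i := Suc (r i))))"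
proof -
  have le: "Suc (N r) \<le> p"
    using total_le [OF r] by (simp only: total_raise [OF i])
  have "Suc (r i) \<le> p"
    using label_le_p [OF r, of i] by simp
  moreover have "p - Suc (N r) + 1 = p - N r"
    using le by simp
  moreover have "p - N r \<le> p"
    by simp
  ultimately show ?thesis
    unfolding normsq_raise [OF assms] plus_coeff_def minus_coeff_def
    by (simp only: total_raise [OF i] raised_label_theta [OF r i] jsign_upd sum_before_upd
          complex_cnj_mult complex_cnj_power cnj_q cnj_jsign fun_upd_same qnum_rnum) simp
qed

lemma matrix_element_adjoint:
  assumes i: "i \<in> {1..n+m}" and rs: "r \<in> L" "s \<in> L"
  shows "complex_of_real (normsq s) * (plus_coeff i r *\<^sub>C K (r(i := r i + 1))) s
      = complex_of_real (normsq r) * cnj ((minus_coeff i s *\<^sub>C K (s(i := s i - 1))) r)"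
proof (cases "s = r(i := Suc (r i))")
  case True
  then show ?thesis
    using normsq_plus_coeff [OF i, of r] rs by (simp add: cscale_apply ket_apply)
next
  case False
  \<comment> \<open>Lowering is inverted by raising only when \<open>s i\<close> is positive; for
    \<open>s i = 0\<close> the subtraction truncates, but the coefficient contains
    \<open>[0]\<close>.\<close>
  have "r(i := Suc (r i)) = s" if "s i \<noteq> 0" "r = s(i := s i - 1)"
    using that(1) by (simp add: that(2))
  then have "s i = 0 \<or> r \<noteq> s(i := s i - 1)"
    using False by metis
  then have "minus_coeff i s * K (s(i := s i - 1)) r = 0"
    by (auto simp: minus_coeff_def ket_apply)
  then show ?thesis
    using False by (simp add: cscale_apply ket_apply)
qed

section \<open>Existence of the form and its values on the kets\<close>

definition form :: "((nat \<Rightarrow> nat) \<Rightarrow> complex) \<Rightarrow> ((nat \<Rightarrow> nat) \<Rightarrow> complex) \<Rightarrow> complex" where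
  "form v w = (\<Sum>r\<in>L. complex_of_real (normsq r) * v r * cnj (w r))"

text \<open>For a diagonal form, adjointness is a weighted conjugate-transpose condition on matrix
  entries; exchanging the two finite sums transfers it to all vectors.\<close>

lemma form_adjoint:
  assumes "\<And>r s. r \<in> L \<Longrightarrow> s \<in> L \<Longrightarrow>
    complex_of_real (normsq s) * F r s = complex_of_real (normsq r) * cnj (G s r)"
  shows "form (lin_ext n m p F v) w = form v (lin_ext n m p G w)"
proof -
  have "form (lin_ext n m p F v) w
      = (\<Sum>s\<in>L. \<Sum>r\<in>L. complex_of_real (normsq s) * F r s * v r * cnj (w s))"
    by (simp add: form_def lin_ext_apply sum_distrib_left sum_distrib_right ac_simps)
  also have "\<dots> = (\<Sum>s\<in>L. \<Sum>r\<in>L. complex_of_real (normsq r) * cnj (G s r) * v r * cnj (w s))"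
    by (intro sum.cong refl) (simp only: assms)
  also have "\<dots> = (\<Sum>r\<in>L. \<Sum>s\<in>L. complex_of_real (normsq r) * cnj (G s r) * v r * cnj (w s))"
    by (rule sum.swap)
  also have "\<dots> = form v (lin_ext n m p G w)"
    by (simp add: form_def lin_ext_apply sum_distrib_left ac_simps)
  finally show ?thesis .
qed

lemma jac_plus_alt:
  "jac_plus n m p q i = lin_ext n m p (\<lambda>r. plus_coeff i r *\<^sub>C K (r(i := r i + 1)))"
  by (simp add: jac_plus_def plus_coeff_def)

lemma jac_minus_alt:
  "jac_minus n m p q i = lin_ext n m p (\<lambda>r. minus_coeff i r *\<^sub>C K (r(i := r i - 1)))"
  by (simp add: jac_minus_def minus_coeff_def)

lemma fock_form_form: "fock_form n m p q form"
  unfolding fock_form_def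
proof (intro conjI ballI)
  show "hermitian_form_on (fock n m p) form"
    unfolding hermitian_form_on_def
    by (auto simp: form_def cscale_apply algebra_simps sum.distrib sum_distrib_left)
  have "form (vacuum n m p) (vacuum n m p) = (\<Sum>r\<in>L. if r = (\<lambda>_. 0) then 1 else 0)"
    unfolding form_def vacuum_def
    by (intro sum.cong) (auto simp: ket_apply normsq_zero zero_label)
  then show "form (vacuum n m p) (vacuum n m p) = 1"
    by (simp add: finite_labels zero_label)
  fix i v w
  assume i: "i \<in> {1..n+m}"
  show "form (jac_plus n m p q i v) w = form v (jac_minus n m p q i w)"
    unfolding jac_plus_alt jac_minus_alt by (intro form_adjoint matrix_element_adjoint i)
  show "form (jac_minus n m p q i v) w = form v (jac_plus n m p q i w)"
    unfolding jac_plus_alt jac_minus_alt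
  proof (rule form_adjoint)
    fix r s
    assume "r \<in> L" "s \<in> L"
    \<comment> \<open>The second relation is the complex conjugate of the first with the two labels
      exchanged.\<close>
    from arg_cong [OF matrix_element_adjoint [OF i this(2,1)], of cnj]
    show "complex_of_real (normsq s) * (minus_coeff i r *\<^sub>C K (r(i := r i - 1))) s
      = complex_of_real (normsq r) * cnj ((plus_coeff i s *\<^sub>C K (s(i := s i + 1))) r)"
      by simp
  qed
  \<comment> \<open>\<open>jac_H\<close> is diagonal on kets with real weights.\<close>
  show "form (jac_H n m p i v) w = form v (jac_H n m p i w)"
    unfolding jac_H_def
    by (intro form_adjoint) (auto simp: cscale_apply ket_apply weight_def)
qed

text \<open>The induction is on the total of \<open>r\<close>, with \<open>s\<close> arbitrary,
  because moving a raising generator across the form lowers both labels at once.\<close>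

lemma fock_form_ket:
  assumes B: "fock_form n m p q B" and "r \<in> L" "s \<in> L"
  shows "B (K r) (K s) = (if r = s then complex_of_real (normsq r) else 0)"
  using assms(2,3)
proof (induction "N r" arbitrary: r s)
  have herm: "hermitian_form_on (fock n m p) B"
    using B by (simp add: fock_form_def)
  have scale_left: "B (c *\<^sub>C v) w = c * B v w"
    if "v \<in> fock n m p" "w \<in> fock n m p" for c v w
    using hermitian_form_scale_left [OF herm that] .
  have scale_right: "B v (c *\<^sub>C w) = cnj c * B v w"
    if "v \<in> fock n m p" "w \<in> fock n m p" for c v w
    using hermitian_form_scale_right [OF herm that] that(2)
    by (simp add: cfun.subspace_scale subspace_fock)
  have herm_sym: "B w v = cnj (B v w)" if "v \<in> fock n m p" "w \<in> fock n m p" for v w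
    using hermitian_form_sym [OF herm that] .
  \<comment> \<open>Adjointness of raising and lowering, read off on two kets.\<close>
  have step: "plus_coeff i r * B (K (r(i := Suc (r i)))) (K s)
      = cnj (minus_coeff i s) * B (K r) (K (s(i := s i - 1)))"
    if "i \<in> {1..n+m}" "r \<in> L" "s \<in> L" for i r s
  proof -
    have "B (jac_plus n m p q i (K r)) (K s) = B (K r) (jac_minus n m p q i (K s))"
      using B that by (simp add: fock_form_def ket_in_fock)
    then show ?thesis
      using jac_plus_ket [OF that(2), of i 1] jac_minus_ket [OF that(3), of i 1]
      by (simp add: scale_left scale_right ket_in_fock)
  qed
  {
    case 0
    have r: "r = (\<lambda>_. 0)"
      using 0 label_le [OF 0(2)] by auto
    show ?case
    proof (cases "s = r")
      case True
      then show ?thesis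
        using B by (simp add: r normsq_zero fock_form_def vacuum_def)
    next
      case False
      then obtain i where i: "s i > 0"
        by (auto simp: r fun_eq_iff)
      define s' where "s' = s(i := s i - 1)"
      have in_range: "i \<in> {1..n+m}"
        using 0(3) i by (force simp: labels_def)
      have s: "s = s'(i := Suc (s' i))"
        using i by (simp add: s'_def)
      have s': "s' \<in> L"
        using lower_label [OF 0(3) in_range i] by (simp add: s'_def)
      \<comment> \<open>Here the nonzero label \<open>s\<close> is the raised one, and the lowering
        generator it becomes annihilates the vacuum \<open>K r\<close>.\<close>
      have "plus_coeff i s' * B (K s) (K r) = 0"
        using step [OF in_range s' 0(2)] by (simp add: s [symmetric]) (simp add: r minus_coeff_def)
      moreover have "plus_coeff i s' \<noteq> 0"
        using plus_coeff_nonzero [OF in_range] 0(3) s by metis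
      ultimately have "B (K s) (K r) = 0"
        by simp
      then show ?thesis
        using herm_sym [OF ket_in_fock ket_in_fock, of s r] False by simp
    qed
  next
    case (Suc k)
    then have "r \<noteq> (\<lambda>_. 0)"
      by (auto simp: total_def)
    then obtain i where i: "r i > 0"
      by (auto simp: fun_eq_iff)
    define r' where "r' = r(i := r i - 1)"
    have in_range: "i \<in> {1..n+m}"
      using Suc.prems(1) i by (force simp: labels_def)
    have r: "r = r'(i := Suc (r' i))"
      using i by (simp add: r'_def)
    have r': "r' \<in> L"
      using lower_label [OF Suc.prems(1) in_range i] by (simp add: r'_def)
    have raised: "r'(i := Suc (r' i)) \<in> L"
      using Suc.prems(1) r by simp
    have k: "k = N r'"
      using Suc.hyps(2) total_raise [OF in_range, of r'] r by simp
    have nz: "plus_coeff i r' \<noteq> 0"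
      using plus_coeff_nonzero [OF in_range raised] .
    have eq: "plus_coeff i r' * B (K r) (K s)
        = cnj (minus_coeff i s) * B (K r') (K (s(i := s i - 1)))"
      using step [OF in_range r' Suc.prems(2)] by (simp add: r [symmetric])
    show ?case
    proof (cases "s i = 0")
      \<comment> \<open>The lowering generator annihilates \<open>K s\<close>, so the form vanishes,
        as it should since \<open>r i > 0 = s i\<close>.\<close>
      case True
      then have "r \<noteq> s"
        using i by auto
      then show ?thesis
        using eq nz True by (simp add: minus_coeff_def)
    next
      case False
      then have IH: "B (K r') (K (s(i := s i - 1)))
          = (if r' = s(i := s i - 1) then complex_of_real (normsq r') else 0)"
        using Suc.hyps(1) [OF k r'] lower_label [OF Suc.prems(2) in_range] by simp
      show ?thesis
      proof (cases "r = s")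
        case True
        have "plus_coeff i r' * B (K r) (K s)
            = plus_coeff i r' * complex_of_real (normsq r)"
          using eq IH normsq_plus_coeff [OF in_range raised] True
          by (simp add: r [symmetric]) (simp add: r'_def ac_simps)
        then show ?thesis
          using nz True by simp
      next
        case neq: False
        \<comment> \<open>Both entries at \<open>i\<close> are positive, so lowering there keeps
          distinct labels distinct.\<close>
        then have "r' \<noteq> s(i := s i - 1)"
          using i False by (auto simp: r'_def fun_eq_iff) (metis Suc_pred)
        then show ?thesis
          using eq IH nz neq by simp
      qed
    qed
  }
qed

section \<open>The normalized basis and the action on it\<close>

lemma nket_alt:
  assumes "r \<in> L"
  shows "nket n m p q r = complex_of_real (1 / sqrt (normsq r)) *\<^sub>C K r"
proof -
  \<comment> \<open>The radicand is a positive real, so \<open>csqrt\<close> is the ordinary real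
    root.\<close>
  have "qfact q (p - N r) / (qfact q p * (\<Prod>i=1..n+m. qfact q (r i)))
      = complex_of_real (1 / normsq r)"
    by (simp add: normsq_def qfact_rfact label_le_p [OF assms])
  then show ?thesis
    using normsq_pos [OF assms] by (simp add: nket_def total_def csqrt_of_real_nonneg real_sqrt_divide)
qed

lemma nket_eq_0: "r \<notin> L \<Longrightarrow> nket n m p q r = 0"
  by (simp add: nket_def ket_eq_0)

lemma orthonormal_nket:
  assumes B: "fock_form n m p q B"
  shows "orthonormal_basis_on (fock n m p) B L (nket n m p q)"
proof -
  define c where "c r = complex_of_real (1 / sqrt (normsq r))" for r
  have nz: "c r \<noteq> 0" if "r \<in> L" for r
    using normsq_pos [OF that] by (simp add: c_def)
  note basis = scaled_kets_basis [where n = n and m = m and p = p and c = c, OF nz]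
  have nket: "nket n m p q r = c r *\<^sub>C K r" if "r \<in> L" for r
    using nket_alt [OF that] by (simp add: c_def)
  have img: "nket n m p q ` L = (\<lambda>r. c r *\<^sub>C K r) ` L"
    by (intro image_cong nket) auto
  have herm: "hermitian_form_on (fock n m p) B"
    using B by (simp add: fock_form_def)
  have "B (nket n m p q r) (nket n m p q s) = (if r = s then 1 else 0)"
    if rs: "r \<in> L" "s \<in> L" for r s
  proof -
    have "B (nket n m p q r) (nket n m p q s) = c r * (cnj (c s) * B (K r) (K s))"
      unfolding nket [OF rs(1)] nket [OF rs(2)]
      by (simp only: hermitian_form_scale_left [OF herm] hermitian_form_scale_right [OF herm]
          ket_in_fock cfun.subspace_scale subspace_fock mult.left_commute)
    also have "\<dots> = (if r = s then 1 else 0)"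
      using normsq_pos [OF rs(1)]
      by (auto simp: fock_form_ket [OF B rs] c_def simp flip: of_real_mult)
    finally show ?thesis .
  qed
  moreover have "inj_on (nket n m p q) L"
    using basis(1) by (simp add: nket cong: inj_on_cong)
  ultimately show ?thesis
    unfolding orthonormal_basis_on_def img
    using basis(2,3) by blast
qed

text \<open>The ratio of neighbouring normalizing factors is the square root that appears in the
  normalized matrix elements of both generators.\<close>

lemma normalization_raise:
  assumes i: "i \<in> {1..n+m}" and r: "r(i := Suc (r i)) \<in> L"
  shows "1 / sqrt (normsq r)
      = sqrt (rnum (Suc (r i)) * rnum (p - N r)) * (1 / sqrt (normsq (r(i := Suc (r i)))))"
proof -
  have "Suc (r i) \<le> p" "Suc (N r) \<le> p"
    using label_le_p [OF r, of i] total_le [OF r] total_raise [OF i, of r] by simp_all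
  then have "rnum (Suc (r i)) * rnum (p - N r) > 0"
    by (intro mult_pos_pos rnum_pos) auto
  then show ?thesis
    by (auto simp: normsq_raise [OF assms] real_sqrt_mult)
qed

lemma csqrt_qnum_mult:
  "k \<le> p \<Longrightarrow> l \<le> p \<Longrightarrow> csqrt (qnum q k * qnum q l) = complex_of_real (sqrt (rnum k * rnum l))"
  using rnum_nonneg by (simp add: qnum_rnum csqrt_of_real_nonneg flip: of_real_mult)

lemma jac_H_nket:
  assumes "r \<in> L"
  shows "jac_H n m p i (nket n m p q r) = weight n m p i r *\<^sub>C nket n m p q r"
  by (simp only: nket_alt [OF assms] jac_H_ket [OF assms])

text \<open>When the raised label leaves the index set, the target vectors on both sides are 0,
  whatever the coefficients.\<close>

lemma jac_plus_nket:
  assumes i: "i \<in> {1..n+m}" and r: "r \<in> L"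
  shows "jac_plus n m p q i (nket n m p q r)
      = (plus_coeff i r * csqrt (qnum q (r i + 1) * qnum q (p - N r)))
          *\<^sub>C nket n m p q (r(i := r i + 1))"
proof (cases "r(i := Suc (r i)) \<in> L")
  case True
  have "Suc (r i) \<le> p"
    using label_le_p [OF True, of i] by simp
  then have "csqrt (qnum q (r i + 1) * qnum q (p - N r))
      = complex_of_real (sqrt (rnum (Suc (r i)) * rnum (p - N r)))"
    by (simp add: csqrt_qnum_mult)
  then show ?thesis
    unfolding nket_alt [OF r] jac_plus_ket [OF r] normalization_raise [OF i True]
    by (simp only: Suc_eq_plus1 [symmetric] nket_alt [OF True]
        cfun.scale_scale of_real_mult mult_ac)
next
  case False
  then show ?thesis
    by (simp add: nket_alt [OF r] jac_plus_ket [OF r] ket_eq_0 nket_eq_0)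
qed

text \<open>With \<open>s\<close> the lowered label, the coefficient carries a product
  \<open>x\<close> of two quantum integers. One factor \<open>sqrt x\<close> passes from the
  normalization of \<open>r\<close> to that of \<open>s\<close>, and the other remains.\<close>

lemma jac_minus_nket:
  assumes i: "i \<in> {1..n+m}" and r: "r \<in> L"
  shows "jac_minus n m p q i (nket n m p q r)
      = (jsign n i r * q ^ (\<Sum>j=1..<i. r j) * csqrt (qnum q (r i) * qnum q (p - N r + 1)))
          *\<^sub>C nket n m p q (r(i := r i - 1))"
proof (cases "r i = 0")
  case True
  then show ?thesis
    by (simp add: nket_alt [OF r] jac_minus_ket [OF r] minus_coeff_def)
next
  case False
  define s where "s = r(i := r i - 1)"
  have s: "s \<in> L" and rs: "r = s(i := Suc (s i))"
    using lower_label [OF r i] False by (simp_all add: s_def)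
  have "N r = Suc (N s)"
    using total_raise [OF i, of s] rs by simp
  \<comment> \<open>This keeps the argument at most \<open>p\<close>, where quantum integers are
    known to be nonnegative reals. The argument \<open>p + 1\<close> occurs only for the zero label,
    where \<open>[0]\<close> cancels it.\<close>
  then have k: "p - N r + 1 = p - N s"
    using total_le [OF r] by simp
  have ri: "r i = Suc (s i)"
    using False by (simp add: s_def)
  define x where "x = rnum (Suc (s i)) * rnum (p - N s)"
  have le: "Suc (s i) \<le> p"
    using label_le_p [OF r, of i] ri by simp
  then have x: "x \<ge> 0"
    unfolding x_def by (intro mult_nonneg_nonneg rnum_nonneg) auto
  have norm: "1 / sqrt (normsq s) = sqrt x * (1 / sqrt (normsq r))"
    using normalization_raise [OF i, of s] r rs by (simp add: x_def)
  have prod: "qnum q (r i) * qnum q (p - N r + 1) = complex_of_real x"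
    using le unfolding ri k x_def by (simp add: qnum_rnum)
  have eq: "complex_of_real (1 / sqrt (normsq r)) * complex_of_real x
      = csqrt (complex_of_real x) * complex_of_real (1 / sqrt (normsq s))"
    using x by (simp add: norm csqrt_of_real_nonneg flip: of_real_mult)
  then show ?thesis
    unfolding nket_alt [OF r] jac_minus_ket [OF r] minus_coeff_def s_def [symmetric]
      nket_alt [OF s] mult.assoc prod cfun.scale_scale
    by (simp only: mult.left_commute [of "complex_of_real (1 / sqrt (normsq r))"] eq)
qed

end

section \<open>Specialization to \<open>q = exp (i phi)\<close>\<close>

lemma unitary_fock_exp_i:
  assumes "\<bar>\<phi>\<bar> < pi / real p"
  shows "unitary_fock p (exp (\<i> * complex_of_real \<phi>))"
proof
  show "cnj (exp (\<i> * complex_of_real \<phi>)) = inverse (exp (\<i> * complex_of_real \<phi>))"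
    by (simp add: cis_conv_exp [symmetric] cis_cnj)
qed (use qnum_exp_i_pos [OF assms] in simp_all)

theorem mainTheorem8:
  fixes n m p :: nat and \<phi> :: real and q :: complex
  assumes "n + m \<ge> 1" and "p \<ge> 2"
    and "- pi / real p < \<phi>" and "\<phi> < pi / real p"
    and "q = exp (\<i> * complex_of_real \<phi>)"
  shows "(\<exists>B. fock_form n m p q B) \<and>
    (\<forall>B. fock_form n m p q B \<longrightarrow>
       orthonormal_basis_on (fock n m p) B (labels n m p) (nket n m p q)) \<and>
    (\<forall>i\<in>{1..n+m}. \<forall>r\<in>labels n m p.
       jac_H n m p i (nket n m p q r)
         = (of_nat p - (-1) ^ theta n i * of_nat (r i) - of_nat (\<Sum>j=1..n+m. r j))
             *\<^sub>C nket n m p q r \<and>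
       jac_minus n m p q i (nket n m p q r)
         = ((-1) ^ (\<Sum>j=1..<i. theta n j * r j) * q ^ (\<Sum>j=1..<i. r j)
              * csqrt (qnum q (r i) * qnum q (p - (\<Sum>l=1..n+m. r l) + 1)))
             *\<^sub>C nket n m p q (r(i := r i - 1)) \<and>
       jac_plus n m p q i (nket n m p q r)
         = ((-1) ^ (\<Sum>j=1..<i. theta n j * r j) * inverse q ^ (\<Sum>j=1..<i. r j)
              * (1 - of_nat (theta n i * r i))
              * csqrt (qnum q (r i + 1) * qnum q (p - (\<Sum>l=1..n+m. r l))))
             *\<^sub>C nket n m p q (r(i := r i + 1)))"
proof -
  interpret unitary_fock n m p q
    unfolding assms(5) using assms(3,4) by (intro unitary_fock_exp_i) linarith
  note actions = jac_H_nket [unfolded weight_def total_def]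
    jac_minus_nket [unfolded jsign_def total_def]
    jac_plus_nket [unfolded plus_coeff_def jsign_def total_def]
  show ?thesis
    by (intro conjI ballI allI impI exI [of _ form] fock_form_form orthonormal_nket actions)
qed

end
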